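(* Let $R$ be a ring, $S\subseteq R$ a multiplicative set, and $I$ a quasi sdf-absorbing ideal of $R$ such that $I\cap S=\emptyset$. Then the localized ideal $S^{-1}I$ is a quasi sdf-absorbing ideal of $S^{-1}R$.
   Context: All rings are commutative with identity. An ideal $I$ of a ring $R$ is called sdf-absorbing if for all non-zero $a,b\in R$, $a^{2}-b^{2}\in I$ implies $a-b\in I$ or $a+b\in I$. A proper ideal $I$ of $R$ is called quasi sdf-absorbing if its radical $\sqrt{I}$ is an sdf-absorbing ideal of $R$. *)

theory Defs
  imports "HOL-Algebra.Ideal"
begin

definition radical :: "('a, 'b) ring_scheme \<Rightarrow> 'a set \<Rightarrow> 'a set"
  where "radical R I = {x \<in> carrier R. \<exists>n::nat. n > 0 \<and> x [^]\<^bsub>R\<^esub> n \<in> I}"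

locale sdf_absorbing_ideal = ideal I R + cring R for I and R (structure) +
  assumes sdf_absorbing:
    "\<lbrakk>a \<in> carrier R; b \<in> carrier R; a \<noteq> \<zero>; b \<noteq> \<zero>; a [^] (2::nat) \<ominus> b [^] (2::nat) \<in> I\<rbrakk>
      \<Longrightarrow> a \<ominus> b \<in> I \<or> a \<oplus> b \<in> I"

locale quasi_sdf_absorbing_ideal = ideal I R + cring R for I and R (structure) +
  assumes proper: "I \<noteq> carrier R"
    and radical_sdf_absorbing: "sdf_absorbing_ideal (radical R I) R"

definition frac_rel :: "('a, 'b) ring_scheme \<Rightarrow> 'a set \<Rightarrow> (('a \<times> 'a) \<times> ('a \<times> 'a)) set"
  where "frac_rel R S = {((a, s), (b, t)). a \<in> carrier R \<and> s \<in> S \<and> b \<in> carrier R \<and> t \<in> S \<and>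
    (\<exists>u\<in>S. u \<otimes>\<^bsub>R\<^esub> (a \<otimes>\<^bsub>R\<^esub> t \<ominus>\<^bsub>R\<^esub> b \<otimes>\<^bsub>R\<^esub> s) = \<zero>\<^bsub>R\<^esub>)}"

definition frac :: "('a, 'b) ring_scheme \<Rightarrow> 'a set \<Rightarrow> 'a \<Rightarrow> 'a \<Rightarrow> ('a \<times> 'a) set"
  where "frac R S a s = frac_rel R S `` {(a, s)}"

text \<open>The unions over representatives are unions of a single equivalence class whenever
  \<open>R\<close> is a commutative ring and \<open>S\<close> a submonoid of it, because the operations on fractions
  are well defined.\<close>

definition localization :: "('a, 'b) ring_scheme \<Rightarrow> 'a set \<Rightarrow> ('a \<times> 'a) set ring"
  where "localization R S =
    \<lparr>carrier = (carrier R \<times> S) // frac_rel R S,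
     monoid.mult = (\<lambda>X Y. \<Union>(a, s)\<in>X. \<Union>(b, t)\<in>Y. frac R S (a \<otimes>\<^bsub>R\<^esub> b) (s \<otimes>\<^bsub>R\<^esub> t)),
     one = frac R S \<one>\<^bsub>R\<^esub> \<one>\<^bsub>R\<^esub>,
     zero = frac R S \<zero>\<^bsub>R\<^esub> \<one>\<^bsub>R\<^esub>,
     add = (\<lambda>X Y. \<Union>(a, s)\<in>X. \<Union>(b, t)\<in>Y.
       frac R S (a \<otimes>\<^bsub>R\<^esub> t \<oplus>\<^bsub>R\<^esub> b \<otimes>\<^bsub>R\<^esub> s) (s \<otimes>\<^bsub>R\<^esub> t))\<rparr>"

definition localized_ideal :: "('a, 'b) ring_scheme \<Rightarrow> 'a set \<Rightarrow> 'a set \<Rightarrow> ('a \<times> 'a) set set"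
  where "localized_ideal R S I = {frac R S a s | a s. a \<in> I \<and> s \<in> S}"

end

theory Submission
  imports Defs
begin

text \<open>
  Localization commutes with taking radicals, so it suffices that it preserves sdf-absorbing ideals
  \<open>J\<close>. If \<open>(a/s)\<^sup>2 - (b/t)\<^sup>2\<close> lies in \<open>S\<inverse>J\<close>, then \<open>u (a\<^sup>2 t\<^sup>2 - b\<^sup>2 s\<^sup>2) \<in> J\<close> for some \<open>u \<in> S\<close>,
  and one more factor \<open>u\<close> turns this into the difference of squares \<open>(uta)\<^sup>2 - (usb)\<^sup>2\<close>. Both
  \<open>uta\<close> and \<open>usb\<close> are non-zero because \<open>a/s\<close> and \<open>b/t\<close> are.
\<close>

section \<open>Fractions and their equality\<close>

locale cring_localization = cring R + submonoid S R for R (structure) and S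
begin

abbreviation L where "L \<equiv> localization R S"

lemma denom_carrier [simp]: "s \<in> S \<Longrightarrow> s \<in> carrier R"
  using subset by blast

text \<open>Distributing \<open>u\<close> over the difference removes the subtraction, so that later
  equalities of fractions are mostly commutative-monoid computations with \<open>m_ac\<close>. The
  witness \<open>u\<close> stays because elements of \<open>S\<close> may be zero divisors.\<close>

lemma frac_rel_iff:
  "((a, s), (b, t)) \<in> frac_rel R S \<longleftrightarrow> a \<in> carrier R \<and> b \<in> carrier R \<and> s \<in> S \<and> t \<in> S \<and>
    (\<exists>u\<in>S. u \<otimes> (a \<otimes> t) = u \<otimes> (b \<otimes> s))"
proof -
  have "u \<otimes> (a \<otimes> t \<ominus> b \<otimes> s) = \<zero> \<longleftrightarrow> u \<otimes> (a \<otimes> t) = u \<otimes> (b \<otimes> s)"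
    if "a \<in> carrier R" "b \<in> carrier R" "s \<in> S" "t \<in> S" "u \<in> S" for u
  proof -
    have "u \<otimes> (a \<otimes> t \<ominus> b \<otimes> s) = u \<otimes> (a \<otimes> t) \<ominus> u \<otimes> (b \<otimes> s)"
      using that by (simp add: minus_eq r_distr r_minus)
    then show ?thesis
      using that by (simp add: a_minus_def add.inv_solve_right')
  qed
  then show ?thesis
    unfolding frac_rel_def by blast
qed

lemma equiv_frac_rel: "equiv (carrier R \<times> S) (frac_rel R S)"
proof (rule equivI)
  show "frac_rel R S \<subseteq> (carrier R \<times> S) \<times> carrier R \<times> S"
    by (auto simp: frac_rel_iff)
  show "refl_on (carrier R \<times> S) (frac_rel R S)"
    by (auto simp: refl_on_def frac_rel_iff)
  show "sym (frac_rel R S)"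
    by (force simp: sym_def frac_rel_iff)
  show "trans (frac_rel R S)"
  proof (rule transI, clarify)
    fix a s b t c w
    assume "((a, s), (b, t)) \<in> frac_rel R S" "((b, t), (c, w)) \<in> frac_rel R S"
    then obtain u v where S: "u \<in> S" "v \<in> S" "s \<in> S" "t \<in> S" "w \<in> S"
      and R: "a \<in> carrier R" "b \<in> carrier R" "c \<in> carrier R"
      and u: "u \<otimes> (a \<otimes> t) = u \<otimes> (b \<otimes> s)" and v: "v \<otimes> (b \<otimes> w) = v \<otimes> (c \<otimes> t)"
      by (auto simp: frac_rel_iff)
    note car = R S[THEN denom_carrier]
    \<comment> \<open>The witness for transitivity is \<open>u \<otimes> v \<otimes> t\<close>: the
      middle denominator \<open>t\<close> is needed to form \<open>a \<otimes> t\<close> and then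
      \<open>c \<otimes> t\<close>, where the two given equations apply, and it cannot be cancelled
      afterwards.\<close>
    have "(u \<otimes> v \<otimes> t) \<otimes> (a \<otimes> w) = (v \<otimes> w) \<otimes> (u \<otimes> (a \<otimes> t))"
      using car by (simp add: m_ac)
    also have "\<dots> = (u \<otimes> s) \<otimes> (v \<otimes> (b \<otimes> w))"
      unfolding u using car by (simp add: m_ac)
    also have "\<dots> = (u \<otimes> v \<otimes> t) \<otimes> (c \<otimes> s)"
      unfolding v using car by (simp add: m_ac)
    finally show "((a, s), (c, w)) \<in> frac_rel R S"
      using R S by (auto simp: frac_rel_iff intro!: bexI[of _ "u \<otimes> v \<otimes> t"])
  qed
qed

lemma frac_eq_iff:
  assumes "a \<in> carrier R" "s \<in> S" "b \<in> carrier R" "t \<in> S"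
  shows "frac R S a s = frac R S b t \<longleftrightarrow> (\<exists>u\<in>S. u \<otimes> (a \<otimes> t) = u \<otimes> (b \<otimes> s))"
  using eq_equiv_class_iff[OF equiv_frac_rel, of "(a, s)" "(b, t)"] assms
  by (auto simp: frac_def frac_rel_iff)

lemma frac_eqI:
  assumes "a \<in> carrier R" "s \<in> S" "b \<in> carrier R" "t \<in> S" "a \<otimes> t = b \<otimes> s"
  shows "frac R S a s = frac R S b t"
  using assms by (auto simp: frac_eq_iff)

lemma frac_cancel:
  assumes "a \<in> carrier R" "s \<in> S" "u \<in> S"
  shows "frac R S (u \<otimes> a) (u \<otimes> s) = frac R S a s"
  by (rule frac_eqI) (use assms in \<open>simp_all add: m_ac\<close>)

text \<open>Turns a choice of representative into an equation of fractions, the form in which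
  \<open>frac_UN_eq\<close> takes its congruence hypothesis.\<close>

lemma mem_frac_iff:
  assumes "a \<in> carrier R" "s \<in> S"
  shows "(b, t) \<in> frac R S a s \<longleftrightarrow> b \<in> carrier R \<and> t \<in> S \<and> frac R S b t = frac R S a s"
  using equiv_class_eq_iff[OF equiv_frac_rel, of "(a, s)" "(b, t)"] assms
  by (auto simp: frac_def)

section \<open>Well-defined multiplication and addition\<close>

text \<open>If \<open>f\<close> takes the same value on all representatives, the double union is a
  union of copies of one set, and it equals that set because both classes are non-empty. This
  reduces the operations of \<open>localization\<close> to independence of representatives.\<close>

lemma frac_UN_eq:
  assumes car: "a \<in> carrier R" "s \<in> S" "b \<in> carrier R" "t \<in> S"
    and cong: "\<And>a' s' b' t'. \<lbrakk>a' \<in> carrier R; s' \<in> S; b' \<in> carrier R; t' \<in> S;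
      frac R S a' s' = frac R S a s; frac R S b' t' = frac R S b t\<rbrakk>
      \<Longrightarrow> f a' s' b' t' = f a s b t"
  shows "(\<Union>(a, s)\<in>frac R S a s. \<Union>(b, t)\<in>frac R S b t. f a s b t) = f a s b t"
proof -
  have ne: "frac R S a s \<noteq> {}" "frac R S b t \<noteq> {}"
    using car mem_frac_iff by blast+
  \<comment> \<open>The opaque name \<open>c\<close> lets \<open>eq\<close> be used as a rewrite
    rule: with \<open>f a s b t\<close> on the right, its right-hand side would match its own
    left-hand side.\<close>
  define c where "c = f a s b t"
  have eq: "f a' s' b' t' = c" if "(a', s') \<in> frac R S a s" "(b', t') \<in> frac R S b t" for a' s' b' t'
    unfolding c_def by (rule cong) (use that car in \<open>simp_all add: mem_frac_iff\<close>)
  have "(\<Union>(a, s)\<in>frac R S a s. \<Union>(b, t)\<in>frac R S b t. f a s b t) =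
      (\<Union>p\<in>frac R S a s. \<Union>q\<in>frac R S b t. c)"
    by (intro SUP_cong refl) (auto simp: eq intro!: SUP_cong)
  then show ?thesis
    using ne by (simp add: c_def)
qed

lemma frac_mult:
  assumes "a \<in> carrier R" "s \<in> S" "b \<in> carrier R" "t \<in> S"
  shows "frac R S a s \<otimes>\<^bsub>L\<^esub> frac R S b t = frac R S (a \<otimes> b) (s \<otimes> t)"
proof -
  have "frac R S (a' \<otimes> b') (s' \<otimes> t') = frac R S (a \<otimes> b) (s \<otimes> t)"
    if R: "a' \<in> carrier R" "b' \<in> carrier R" and S: "s' \<in> S" "t' \<in> S"
      and eq: "frac R S a' s' = frac R S a s" "frac R S b' t' = frac R S b t" for a' s' b' t'
  proof -
    obtain u v where uv: "u \<in> S" "v \<in> S" and u: "u \<otimes> (a' \<otimes> s) = u \<otimes> (a \<otimes> s')"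
      and v: "v \<otimes> (b' \<otimes> t) = v \<otimes> (b \<otimes> t')"
      using eq R S assms by (auto simp: frac_eq_iff)
    note car = R S[THEN denom_carrier] assms denom_carrier[OF assms(2)] denom_carrier[OF assms(4)]
      uv[THEN denom_carrier]
    \<comment> \<open>The product of the two witnesses serves both factors: regrouping isolates each
      known equation.\<close>
    have "(u \<otimes> v) \<otimes> ((a' \<otimes> b') \<otimes> (s \<otimes> t)) = (u \<otimes> (a' \<otimes> s)) \<otimes> (v \<otimes> (b' \<otimes> t))"
      using car by (simp add: m_ac)
    also have "\<dots> = (u \<otimes> v) \<otimes> ((a \<otimes> b) \<otimes> (s' \<otimes> t'))"
      unfolding u v using car by (simp add: m_ac)
    finally show ?thesis
      using R S uv assms by (auto simp: frac_eq_iff intro!: bexI[of _ "u \<otimes> v"])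
  qed
  then show ?thesis
    using frac_UN_eq[OF assms, of "\<lambda>a s b t. frac R S (a \<otimes> b) (s \<otimes> t)"]
    by (simp add: localization_def)
qed

lemma frac_add:
  assumes "a \<in> carrier R" "s \<in> S" "b \<in> carrier R" "t \<in> S"
  shows "frac R S a s \<oplus>\<^bsub>L\<^esub> frac R S b t = frac R S (a \<otimes> t \<oplus> b \<otimes> s) (s \<otimes> t)"
proof -
  have "frac R S (a' \<otimes> t' \<oplus> b' \<otimes> s') (s' \<otimes> t') = frac R S (a \<otimes> t \<oplus> b \<otimes> s) (s \<otimes> t)"
    if R: "a' \<in> carrier R" "b' \<in> carrier R" and S: "s' \<in> S" "t' \<in> S"
      and eq: "frac R S a' s' = frac R S a s" "frac R S b' t' = frac R S b t" for a' s' b' t'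
  proof -
    obtain u v where uv: "u \<in> S" "v \<in> S" and u: "u \<otimes> (a' \<otimes> s) = u \<otimes> (a \<otimes> s')"
      and v: "v \<otimes> (b' \<otimes> t) = v \<otimes> (b \<otimes> t')"
      using eq R S assms by (auto simp: frac_eq_iff)
    note car = R S[THEN denom_carrier] assms denom_carrier[OF assms(2)] denom_carrier[OF assms(4)]
      uv[THEN denom_carrier]
    \<comment> \<open>After distributing, each summand contains the left side of exactly one of the
      two known equations, so the witness \<open>u \<otimes> v\<close> works here too.\<close>
    have "(u \<otimes> v) \<otimes> ((a' \<otimes> t' \<oplus> b' \<otimes> s') \<otimes> (s \<otimes> t)) =
        (v \<otimes> t \<otimes> t') \<otimes> (u \<otimes> (a' \<otimes> s)) \<oplus> (u \<otimes> s \<otimes> s') \<otimes> (v \<otimes> (b' \<otimes> t))"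
      using car by (simp add: m_ac l_distr r_distr)
    also have "\<dots> = (u \<otimes> v) \<otimes> ((a \<otimes> t \<oplus> b \<otimes> s) \<otimes> (s' \<otimes> t'))"
      unfolding u v using car by (simp add: m_ac l_distr r_distr)
    finally show ?thesis
      using R S uv assms by (auto simp: frac_eq_iff intro!: bexI[of _ "u \<otimes> v"])
  qed
  then show ?thesis
    using frac_UN_eq[OF assms, of "\<lambda>a s b t. frac R S (a \<otimes> t \<oplus> b \<otimes> s) (s \<otimes> t)"]
    by (simp add: localization_def)
qed

section \<open>Ring structure of the localization\<close>

lemma zero_localization: "\<zero>\<^bsub>L\<^esub> = frac R S \<zero> \<one>"
  and one_localization: "\<one>\<^bsub>L\<^esub> = frac R S \<one> \<one>"
  by (simp_all add: localization_def)

lemma frac_closed [simp]: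
  "a \<in> carrier R \<Longrightarrow> s \<in> S \<Longrightarrow> frac R S a s \<in> carrier L"
  by (simp add: localization_def frac_def quotientI)

lemma localization_cases:
  assumes "x \<in> carrier L"
  obtains a s where "a \<in> carrier R" "s \<in> S" "x = frac R S a s"
  using assms by (auto simp: localization_def frac_def elim!: quotientE)

text \<open>Its contrapositive matters later: no element of \<open>S\<close> annihilates the
  numerator of a non-zero fraction.\<close>

lemma frac_eq_zero:
  assumes "a \<in> carrier R" "s \<in> S" "u \<in> S" "u \<otimes> a = \<zero>"
  shows "frac R S a s = \<zero>\<^bsub>L\<^esub>"
  using assms by (auto simp: zero_localization frac_eq_iff)

lemma frac_zero: "s \<in> S \<Longrightarrow> frac R S \<zero> s = \<zero>\<^bsub>L\<^esub>"
  by (rule frac_eq_zero[of _ _ \<one>]) auto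

lemma cring_localization: "cring L"
proof (rule cringI)
  show "abelian_group L"
  proof (rule abelian_groupI)
    fix x y assume "x \<in> carrier L" "y \<in> carrier L"
    then show "x \<oplus>\<^bsub>L\<^esub> y \<in> carrier L"
      by (elim localization_cases) (simp add: frac_add)
  next
    show "\<zero>\<^bsub>L\<^esub> \<in> carrier L" by (simp add: zero_localization)
  next
    fix x y z assume "x \<in> carrier L" "y \<in> carrier L" "z \<in> carrier L"
    then show "x \<oplus>\<^bsub>L\<^esub> y \<oplus>\<^bsub>L\<^esub> z = x \<oplus>\<^bsub>L\<^esub> (y \<oplus>\<^bsub>L\<^esub> z)"
      by (elim localization_cases) (simp add: frac_add l_distr r_distr m_ac a_ac)
  next
    fix x y assume "x \<in> carrier L" "y \<in> carrier L"
    then show "x \<oplus>\<^bsub>L\<^esub> y = y \<oplus>\<^bsub>L\<^esub> x"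
      by (elim localization_cases) (simp add: frac_add m_ac a_ac)
  next
    fix x assume "x \<in> carrier L"
    then show "\<zero>\<^bsub>L\<^esub> \<oplus>\<^bsub>L\<^esub> x = x"
      by (elim localization_cases) (simp add: zero_localization frac_add)
  next
    fix x assume "x \<in> carrier L"
    then obtain a s where as: "a \<in> carrier R" "s \<in> S" "x = frac R S a s"
      by (rule localization_cases)
    then have "frac R S (\<ominus> a) s \<oplus>\<^bsub>L\<^esub> x = frac R S \<zero> (s \<otimes> s)"
      by (simp add: frac_add l_minus l_neg)
    then show "\<exists>y\<in>carrier L. y \<oplus>\<^bsub>L\<^esub> x = \<zero>\<^bsub>L\<^esub>"
      using as by (intro bexI[of _ "frac R S (\<ominus> a) s"]) (simp_all add: frac_zero)
  qed
  show "comm_monoid L"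
  proof (rule comm_monoidI)
    fix x y assume "x \<in> carrier L" "y \<in> carrier L"
    then show "x \<otimes>\<^bsub>L\<^esub> y \<in> carrier L"
      by (elim localization_cases) (simp add: frac_mult)
  next
    show "\<one>\<^bsub>L\<^esub> \<in> carrier L" by (simp add: one_localization)
  next
    fix x y z assume "x \<in> carrier L" "y \<in> carrier L" "z \<in> carrier L"
    then show "x \<otimes>\<^bsub>L\<^esub> y \<otimes>\<^bsub>L\<^esub> z = x \<otimes>\<^bsub>L\<^esub> (y \<otimes>\<^bsub>L\<^esub> z)"
      by (elim localization_cases) (simp add: frac_mult m_ac)
  next
    fix x assume "x \<in> carrier L"
    then show "\<one>\<^bsub>L\<^esub> \<otimes>\<^bsub>L\<^esub> x = x"
      by (elim localization_cases) (simp add: one_localization frac_mult)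
  next
    fix x y assume "x \<in> carrier L" "y \<in> carrier L"
    then show "x \<otimes>\<^bsub>L\<^esub> y = y \<otimes>\<^bsub>L\<^esub> x"
      by (elim localization_cases) (simp add: frac_mult m_ac)
  qed
  fix x y z assume "x \<in> carrier L" "y \<in> carrier L" "z \<in> carrier L"
  \<comment> \<open>Distributivity is not an identity of representatives: the denominator on the
    right has an extra factor, that of \<open>z\<close>. Hence cross-multiplication by
    \<open>frac_eqI\<close> instead of simplification alone.\<close>
  then show "(x \<oplus>\<^bsub>L\<^esub> y) \<otimes>\<^bsub>L\<^esub> z = x \<otimes>\<^bsub>L\<^esub> z \<oplus>\<^bsub>L\<^esub> y \<otimes>\<^bsub>L\<^esub> z"
    by (elim localization_cases)
      (simp add: frac_mult frac_add, rule frac_eqI, simp_all add: l_distr r_distr m_ac)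
qed

sublocale L: cring L
  by (rule cring_localization)

lemma frac_a_inv:
  assumes "a \<in> carrier R" "s \<in> S"
  shows "\<ominus>\<^bsub>L\<^esub> frac R S a s = frac R S (\<ominus> a) s"
proof (rule L.minus_equality)
  show "frac R S (\<ominus> a) s \<oplus>\<^bsub>L\<^esub> frac R S a s = \<zero>\<^bsub>L\<^esub>"
    using assms by (simp add: frac_add l_minus l_neg frac_zero)
qed (use assms in simp_all)

lemma frac_minus:
  assumes "a \<in> carrier R" "s \<in> S" "b \<in> carrier R" "t \<in> S"
  shows "frac R S a s \<ominus>\<^bsub>L\<^esub> frac R S b t = frac R S (a \<otimes> t \<ominus> b \<otimes> s) (s \<otimes> t)"
  using assms by (simp add: a_minus_def frac_a_inv frac_add l_minus)

lemma denom_pow_closed [simp]: "s \<in> S \<Longrightarrow> s [^] (n::nat) \<in> S"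
  by (induction n) auto

lemma frac_pow:
  assumes "a \<in> carrier R" "s \<in> S"
  shows "frac R S a s [^]\<^bsub>L\<^esub> (n::nat) = frac R S (a [^] n) (s [^] n)"
  using assms by (induction n) (simp_all add: one_localization frac_mult)

section \<open>Localized ideals\<close>

text \<open>A fraction in the localized ideal has some representative with numerator in
  \<open>J\<close>, but a given numerator \<open>a\<close> need not lie there. If
  \<open>a/s = b/t\<close> with \<open>b\<close> in \<open>J\<close>, clearing denominators puts a
  multiple of \<open>a\<close> by an element of \<open>S\<close> into \<open>J\<close>; conversely
  \<open>a/s\<close> equals \<open>(u \<otimes> a)/(u \<otimes> s)\<close>.\<close>

lemma frac_mem_localized_ideal_iff:
  assumes "ideal J R" "a \<in> carrier R" "s \<in> S"
  shows "frac R S a s \<in> localized_ideal R S J \<longleftrightarrow> (\<exists>u\<in>S. u \<otimes> a \<in> J)"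
proof
  interpret J: ideal J R by fact
  assume "frac R S a s \<in> localized_ideal R S J"
  then obtain b t u where b: "b \<in> J" and S: "t \<in> S" "u \<in> S"
    and eq: "u \<otimes> (a \<otimes> t) = u \<otimes> (b \<otimes> s)"
    using assms J.Icarr by (auto simp: localized_ideal_def frac_eq_iff)
  have "(u \<otimes> t) \<otimes> a = u \<otimes> (b \<otimes> s)"
    using assms S by (simp add: eq[symmetric] m_ac)
  also have "\<dots> \<in> J"
    using assms b S by (simp add: J.I_l_closed J.I_r_closed)
  finally show "\<exists>u\<in>S. u \<otimes> a \<in> J"
    using S by blast
next
  assume "\<exists>u\<in>S. u \<otimes> a \<in> J"
  then obtain u where u: "u \<in> S" "u \<otimes> a \<in> J" by blast
  moreover have "frac R S a s = frac R S (u \<otimes> a) (u \<otimes> s)"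
    using assms u by (simp add: frac_cancel)
  ultimately show "frac R S a s \<in> localized_ideal R S J"
    using assms unfolding localized_ideal_def by blast
qed

lemma localized_ideal_cases:
  assumes "ideal J R" "x \<in> localized_ideal R S J"
  obtains a s where "a \<in> J" "a \<in> carrier R" "s \<in> S" "x = frac R S a s"
  using assms ideal.Icarr[OF assms(1)] by (auto simp: localized_ideal_def)

lemma frac_mem_localized_ideal: "a \<in> J \<Longrightarrow> s \<in> S \<Longrightarrow> frac R S a s \<in> localized_ideal R S J"
  by (auto simp: localized_ideal_def)

lemma ideal_localized_ideal:
  assumes J: "ideal J R"
  shows "ideal (localized_ideal R S J) L"
proof -
  interpret J: ideal J R by fact
  show ?thesis
  proof (rule idealI)
    show "ring L" by (rule L.ring_axioms)
    show "subgroup (localized_ideal R S J) (add_monoid L)"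
    proof (rule L.add.subgroupI)
      show "localized_ideal R S J \<subseteq> carrier L"
        by (auto elim!: localized_ideal_cases[OF J])
      show "localized_ideal R S J \<noteq> {}"
        using frac_mem_localized_ideal[OF J.zero_closed one_closed] by blast
    next
      fix x assume "x \<in> localized_ideal R S J"
      then show "\<ominus>\<^bsub>L\<^esub> x \<in> localized_ideal R S J"
        by (auto elim!: localized_ideal_cases[OF J] intro!: frac_mem_localized_ideal
            simp: frac_a_inv)
    next
      fix x y assume "x \<in> localized_ideal R S J" "y \<in> localized_ideal R S J"
      then show "x \<oplus>\<^bsub>L\<^esub> y \<in> localized_ideal R S J"
        by (auto elim!: localized_ideal_cases[OF J] intro!: frac_mem_localized_ideal J.a_closed
            simp: frac_add J.I_r_closed)
    qed
    fix x y assume "x \<in> localized_ideal R S J" "y \<in> carrier L"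
    then show "y \<otimes>\<^bsub>L\<^esub> x \<in> localized_ideal R S J" "x \<otimes>\<^bsub>L\<^esub> y \<in> localized_ideal R S J"
      by (auto elim!: localized_ideal_cases[OF J] localization_cases
          intro!: frac_mem_localized_ideal simp: frac_mult J.I_l_closed J.I_r_closed)
  qed
qed

text \<open>If the localized ideal contained \<open>1/1\<close>, the membership criterion would give
  an element of \<open>S\<close> lying in \<open>J\<close>.\<close>

lemma localized_ideal_proper:
  assumes "ideal J R" "J \<inter> S = {}"
  shows "localized_ideal R S J \<noteq> carrier L"
proof
  assume "localized_ideal R S J = carrier L"
  then have "frac R S \<one> \<one> \<in> localized_ideal R S J"
    by simp
  then obtain u where "u \<in> S" "u \<otimes> \<one> \<in> J"
    using assms by (auto simp: frac_mem_localized_ideal_iff)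
  then show False
    using assms by auto
qed

section \<open>Radicals commute with localization\<close>

lemma radical_localized_ideal:
  assumes I: "ideal I R"
  shows "radical L (localized_ideal R S I) = localized_ideal R S (radical R I)"
proof (intro equalityI subsetI)
  interpret I: ideal I R by fact
  fix x assume "x \<in> radical L (localized_ideal R S I)"
  then obtain n a s where n: "n > (0::nat)" and as: "a \<in> carrier R" "s \<in> S" and x: "x = frac R S a s"
    and "x [^]\<^bsub>L\<^esub> n \<in> localized_ideal R S I"
    by (auto simp: radical_def elim: localization_cases)
  then obtain u where u: "u \<in> S" "u \<otimes> a [^] n \<in> I"
    by (auto simp: frac_pow frac_mem_localized_ideal_iff[OF I])
  \<comment> \<open>Only one factor \<open>u\<close> comes with \<open>a [^] n\<close>; the missing
    \<open>n - 1\<close> factors are supplied by the ideal property. Positivity of \<open>n\<close>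
    makes the exponents add up to \<open>n\<close>.\<close>
  have "(u \<otimes> a) [^] n = u [^] (n - 1) \<otimes> (u \<otimes> a [^] n)"
    using n as u by (cases n) (simp_all add: pow_mult_distrib m_comm m_ac)
  then have "u \<otimes> a \<in> radical R I"
    using n as u by (auto simp: radical_def I.I_l_closed intro!: exI[of _ n])
  moreover have "x = frac R S (u \<otimes> a) (u \<otimes> s)"
    unfolding x using as u by (simp add: frac_cancel)
  ultimately show "x \<in> localized_ideal R S (radical R I)"
    using as u by (auto intro: frac_mem_localized_ideal)
next
  fix x assume "x \<in> localized_ideal R S (radical R I)"
  \<comment> \<open>If \<open>a [^] n\<close> lies in \<open>I\<close>, then so does the numerator
    of the \<open>n\<close>-th power of \<open>a/s\<close>. The instance of
    \<open>localized_ideal_def\<close> unfolds only the localization of the radical and leaves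
    \<open>localized_ideal R S I\<close> folded for the introduction rule.\<close>
  then show "x \<in> radical L (localized_ideal R S I)"
    by (force simp: radical_def localized_ideal_def[of R S "{x \<in> carrier R. _ x}"] frac_pow
        intro: frac_mem_localized_ideal)
qed

section \<open>Localization preserves sdf-absorbing ideals\<close>

lemma sdf_absorbing_localized_ideal:
  assumes "sdf_absorbing_ideal J R"
  shows "sdf_absorbing_ideal (localized_ideal R S J) L"
proof -
  interpret J: sdf_absorbing_ideal J R by fact
  note J = J.ideal_axioms
  have "x \<ominus>\<^bsub>L\<^esub> y \<in> localized_ideal R S J \<or> x \<oplus>\<^bsub>L\<^esub> y \<in> localized_ideal R S J"
    if xy: "x \<in> carrier L" "y \<in> carrier L" "x \<noteq> \<zero>\<^bsub>L\<^esub>" "y \<noteq> \<zero>\<^bsub>L\<^esub>"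
      and diff: "x [^]\<^bsub>L\<^esub> (2::nat) \<ominus>\<^bsub>L\<^esub> y [^]\<^bsub>L\<^esub> (2::nat) \<in> localized_ideal R S J" for x y
  proof -
    obtain a s b t where R: "a \<in> carrier R" "b \<in> carrier R" and S: "s \<in> S" "t \<in> S"
      and x: "x = frac R S a s" and y: "y = frac R S b t"
      using xy by (metis localization_cases)
    have "frac R S (a [^] (2::nat) \<otimes> t [^] (2::nat) \<ominus> b [^] (2::nat) \<otimes> s [^] (2::nat))
        (s [^] (2::nat) \<otimes> t [^] (2::nat)) \<in> localized_ideal R S J"
      using diff R S by (simp add: x y frac_pow frac_minus)
    then obtain u where u: "u \<in> S"
      and "u \<otimes> (a [^] (2::nat) \<otimes> t [^] (2::nat) \<ominus> b [^] (2::nat) \<otimes> s [^] (2::nat)) \<in> J"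
      using R S by (auto simp: frac_mem_localized_ideal_iff[OF J])
    then have "u \<otimes> (u \<otimes> (a [^] (2::nat) \<otimes> t [^] (2::nat) \<ominus> b [^] (2::nat) \<otimes> s [^] (2::nat))) \<in> J"
      by (simp add: J.I_l_closed)
    also have "u \<otimes> (u \<otimes> (a [^] (2::nat) \<otimes> t [^] (2::nat) \<ominus> b [^] (2::nat) \<otimes> s [^] (2::nat))) =
        (u \<otimes> t \<otimes> a) [^] (2::nat) \<ominus> (u \<otimes> s \<otimes> b) [^] (2::nat)"
      using R S u by (simp add: numeral_2_eq_2 a_minus_def r_distr r_minus m_ac)
    finally have "(u \<otimes> t \<otimes> a) [^] (2::nat) \<ominus> (u \<otimes> s \<otimes> b) [^] (2::nat) \<in> J" .
    \<comment> \<open>Otherwise \<open>u \<otimes> t\<close> or \<open>u \<otimes> s\<close>, both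
      in \<open>S\<close>, would annihilate \<open>a\<close> or \<open>b\<close> and make
      \<open>x\<close> or \<open>y\<close> zero.\<close>
    moreover have "u \<otimes> t \<otimes> a \<noteq> \<zero>" "u \<otimes> s \<otimes> b \<noteq> \<zero>"
      using xy frac_eq_zero[of a s "u \<otimes> t"] frac_eq_zero[of b t "u \<otimes> s"] R S u
      by (auto simp: x y)
    ultimately have "u \<otimes> t \<otimes> a \<ominus> u \<otimes> s \<otimes> b \<in> J \<or> u \<otimes> t \<otimes> a \<oplus> u \<otimes> s \<otimes> b \<in> J"
      using J.sdf_absorbing R S u by simp
    \<comment> \<open>Factoring out \<open>u\<close> exposes the numerators of the difference and
      the sum of \<open>x\<close> and \<open>y\<close>, so the membership criterion applies with
      witness \<open>u\<close>.\<close>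
    moreover have "u \<otimes> t \<otimes> a \<ominus> u \<otimes> s \<otimes> b = u \<otimes> (a \<otimes> t \<ominus> b \<otimes> s)"
      "u \<otimes> t \<otimes> a \<oplus> u \<otimes> s \<otimes> b = u \<otimes> (a \<otimes> t \<oplus> b \<otimes> s)"
      using R S u by (simp_all add: a_minus_def r_distr r_minus m_ac)
    ultimately show ?thesis
      using R S u by (auto simp: x y frac_minus frac_add frac_mem_localized_ideal_iff[OF J])
  qed
  then show ?thesis
    by (intro sdf_absorbing_ideal.intro sdf_absorbing_ideal_axioms.intro
        ideal_localized_ideal J L.cring_axioms)
qed

end

theorem proposition3p1:
  fixes R (structure) and S I :: "'a set"
  assumes "cring R"
    and "submonoid S R"
    and "quasi_sdf_absorbing_ideal I R"
    and "I \<inter> S = {}"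
  shows "quasi_sdf_absorbing_ideal (localized_ideal R S I) (localization R S)"
proof -
  interpret cring_localization R S
    using assms by (intro cring_localization.intro)
  interpret I: quasi_sdf_absorbing_ideal I R by fact
  note I = I.ideal_axioms
  show ?thesis
  proof (intro quasi_sdf_absorbing_ideal.intro quasi_sdf_absorbing_ideal_axioms.intro)
    show "sdf_absorbing_ideal (radical L (localized_ideal R S I)) L"
      \<comment> \<open>The goal becomes one about the localization of \<open>radical R I\<close>,
        whose sdf-absorbing property, including that it is an ideal, is part of the hypothesis on
        \<open>I\<close>.\<close>
      unfolding radical_localized_ideal[OF I]
      by (rule sdf_absorbing_localized_ideal[OF I.radical_sdf_absorbing])
  \<comment> \<open>Disjointness of \<open>I\<close> and \<open>S\<close> enters here, as properness
    of the localized ideal.\<close>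
  qed (rule ideal_localized_ideal[OF I] L.cring_axioms localized_ideal_proper[OF I assms(4)])+
qed

end
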